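(* There is a function $\phi:\mathbb{R}\to\mathbb{R}$ such that, for every $\sigma_w>0$, if $\sigma_b=0$, then for the random networks with activation $\phi$ and parameters $\sigma_w,\sigma_b$: (a) for every finite width $N$, the random variable $h_{2,1}$ does not have a Gaussian distribution; and (b) $h_{2,1}$ diverges as $N\to\infty$, i.e. the distribution of $h_{2,1}=h_{2,1}^{(N)}$ does not converge in distribution to any probability distribution on $\mathbb{R}$ as $N\to\infty$.
   Context: Random network of width $N\ge1$ and depth $D\ge 2$: $\mathrm{Gauss}(0,s^2)$ denotes the normal distribution with mean $0$ and variance $s^2$ (the point mass at $0$ if $s=0$). Fix an arbitrary function $\chi:\mathbb{N}\to\{-1,1\}$; the input for width $N$ is $x_{0,:}=(\chi(1),\dots,\chi(N))\in\{-1,1\}^N$. All entries of $W\in\mathbb{R}^{D\times N\times N}$ and $b\in\mathbb{R}^{D\times N}$ are independent, with $W_{\ell,i,j}\sim\mathrm{Gauss}(0,\sigma_w^2/N)$ and $b_{\ell,i}\sim\mathrm{Gauss}(0,\sigma_b^2)$. For $\ell=1,\dots,D$ and $i=1,\dots,N$, $$h_{\ell,i}=\sum_{j=1}^N W_{\ell,i,j}\,x_{\ell-1,j}+b_{\ell,i},\qquad x_{\ell,i}=\phi(h_{\ell,i}).$$ The choice of $\phi$ is independent of $\chi$, $\sigma_w$ and $N$. *)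

theory Defs
  imports "HOL-Probability.Probability"
begin

text \<open>Normal distribution with mean \<open>\<mu>\<close> and variance \<open>s\<^sup>2\<close>, i.e. the second parameter
  is the standard deviation; the point mass at \<open>\<mu>\<close> counts as the normal distribution of
  variance \<open>0\<close>.\<close>

definition gauss :: "real \<Rightarrow> real \<Rightarrow> real measure" where
  "gauss \<mu> s = (if s = 0 then return borel \<mu> else density lborel (\<lambda>x. ennreal (normal_density \<mu> s x)))"

definition gaussian_distribution :: "real measure \<Rightarrow> bool" where
  "gaussian_distribution \<nu> \<longleftrightarrow> (\<exists>\<mu> s. 0 \<le> s \<and> \<nu> = gauss \<mu> s)"

text \<open>Names of the scalar parameters \<open>W\<^bsub>l,i,j\<^esub>\<close> and \<open>b\<^bsub>l,i\<^esub>\<close>; a function \<open>\<omega> :: param \<Rightarrow> real\<close> is one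
  realisation of all of them.\<close>

datatype param = Weight nat nat nat | Bias nat nat

definition params :: "nat \<Rightarrow> nat \<Rightarrow> param set" where
  "params D N = {Weight l i j | l i j. l \<in> {1..D} \<and> i \<in> {1..N} \<and> j \<in> {1..N}}
              \<union> {Bias l i | l i. l \<in> {1..D} \<and> i \<in> {1..N}}"

fun param_dist :: "real \<Rightarrow> real \<Rightarrow> nat \<Rightarrow> param \<Rightarrow> real measure" where
  "param_dist \<sigma>w \<sigma>b N (Weight l i j) = gauss 0 (\<sigma>w / sqrt (real N))"
| "param_dist \<sigma>w \<sigma>b N (Bias l i) = gauss 0 \<sigma>b"

text \<open>Joint law of all parameters of a random network of width \<open>N\<close> and depth \<open>D\<close>; the product
  measure makes the entries independent.\<close>

definition param_space :: "real \<Rightarrow> real \<Rightarrow> nat \<Rightarrow> nat \<Rightarrow> (param \<Rightarrow> real) measure" where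
  "param_space \<sigma>w \<sigma>b D N = PiM (params D N) (param_dist \<sigma>w \<sigma>b N)"

definition affine_layer :: "nat \<Rightarrow> (param \<Rightarrow> real) \<Rightarrow> nat \<Rightarrow> (nat \<Rightarrow> real) \<Rightarrow> nat \<Rightarrow> real" where
  "affine_layer N \<omega> l x i = (\<Sum>j=1..N. \<omega> (Weight l i j) * x j) + \<omega> (Bias l i)"

text \<open>\<open>hidden \<phi> chi N \<omega> l i\<close> is \<open>x\<^bsub>l,i\<^esub>\<close>, with input \<open>x\<^bsub>0,i\<^esub> = chi i\<close>.\<close>

primrec hidden :: "(real \<Rightarrow> real) \<Rightarrow> (nat \<Rightarrow> real) \<Rightarrow> nat \<Rightarrow> (param \<Rightarrow> real) \<Rightarrow> nat \<Rightarrow> nat \<Rightarrow> real" where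
  "hidden \<phi> chi N \<omega> 0 = chi"
| "hidden \<phi> chi N \<omega> (Suc l) = (\<lambda>i. \<phi> (affine_layer N \<omega> (Suc l) (hidden \<phi> chi N \<omega> l) i))"

text \<open>\<open>preact \<phi> chi N \<omega> l i\<close> is \<open>h\<^bsub>l,i\<^esub>\<close>; only meaningful for \<open>1 \<le> l\<close>.\<close>

definition preact :: "(real \<Rightarrow> real) \<Rightarrow> (nat \<Rightarrow> real) \<Rightarrow> nat \<Rightarrow> (param \<Rightarrow> real) \<Rightarrow> nat \<Rightarrow> nat \<Rightarrow> real" where
  "preact \<phi> chi N \<omega> l i = affine_layer N \<omega> l (hidden \<phi> chi N \<omega> (l - 1)) i"

text \<open>Distribution of \<open>h\<^bsub>l,i\<^esub>\<close>.\<close>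

definition preact_law ::
  "(real \<Rightarrow> real) \<Rightarrow> (nat \<Rightarrow> real) \<Rightarrow> real \<Rightarrow> real \<Rightarrow> nat \<Rightarrow> nat \<Rightarrow> nat \<Rightarrow> nat \<Rightarrow> real measure" where
  "preact_law \<phi> chi \<sigma>w \<sigma>b D N l i = distr (param_space \<sigma>w \<sigma>b D N) borel (\<lambda>\<omega>. preact \<phi> chi N \<omega> l i)"

lemma hidden_eq_preact: "0 < l \<Longrightarrow> hidden \<phi> chi N \<omega> l i = \<phi> (preact \<phi> chi N \<omega> l i)"
  by (cases l) (simp_all add: preact_def)

lemma sets_gauss [simp, measurable_cong]: "sets (gauss \<mu> s) = sets borel"
  by (simp add: gauss_def)

lemma prob_space_gauss:
  assumes "0 \<le> s" shows "prob_space (gauss \<mu> s)"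
  using assms by (auto simp: gauss_def intro!: prob_space_return prob_space_normal_density)

lemma sets_param_dist [simp]: "sets (param_dist \<sigma>w \<sigma>b N p) = sets borel"
  by (cases p) simp_all

lemma prob_space_param_space:
  assumes "0 \<le> \<sigma>w" "0 \<le> \<sigma>b" shows "prob_space (param_space \<sigma>w \<sigma>b D N)"
  unfolding param_space_def
proof (rule prob_space_PiM)
  fix p show "prob_space (param_dist \<sigma>w \<sigma>b N p)"
    using assms by (cases p) (auto intro!: prob_space_gauss)
qed

lemma measurable_param:
  assumes "p \<in> params D N"
  shows "(\<lambda>\<omega>. \<omega> p) \<in> borel_measurable (param_space \<sigma>w \<sigma>b D N)"
  using measurable_component_singleton[OF assms, of "param_dist \<sigma>w \<sigma>b N"]
  by (simp add: param_space_def cong: measurable_cong_sets)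

lemma measurable_affine_layer:
  assumes "l \<in> {1..D}" "i \<in> {1..N}"
    and "\<And>j. j \<in> {1..N} \<Longrightarrow> (\<lambda>\<omega>. x \<omega> j) \<in> borel_measurable (param_space \<sigma>w \<sigma>b D N)"
  shows "(\<lambda>\<omega>. affine_layer N \<omega> l (x \<omega>) i) \<in> borel_measurable (param_space \<sigma>w \<sigma>b D N)"
  unfolding affine_layer_def using assms
  by (intro borel_measurable_add borel_measurable_sum borel_measurable_times measurable_param)
    (auto simp: params_def)

lemma measurable_hidden:
  assumes "\<phi> \<in> borel_measurable borel" "l \<le> D" "i \<in> {1..N}"
  shows "(\<lambda>\<omega>. hidden \<phi> chi N \<omega> l i) \<in> borel_measurable (param_space \<sigma>w \<sigma>b D N)"
  using assms(2,3)
proof (induction l arbitrary: i)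
  case (Suc l)
  then have "(\<lambda>\<omega>. affine_layer N \<omega> (Suc l) (hidden \<phi> chi N \<omega> l) i)
      \<in> borel_measurable (param_space \<sigma>w \<sigma>b D N)"
    by (intro measurable_affine_layer) auto
  from measurable_compose[OF this assms(1)] show ?case by simp
qed simp

lemma measurable_preact:
  assumes "\<phi> \<in> borel_measurable borel" "l \<in> {1..D}" "i \<in> {1..N}"
  shows "(\<lambda>\<omega>. preact \<phi> chi N \<omega> l i) \<in> borel_measurable (param_space \<sigma>w \<sigma>b D N)"
  unfolding preact_def using assms
  by (intro measurable_affine_layer measurable_hidden) auto

end

(* The activation x |-> exp (x^4) has infinite second moment under every centred Gaussian of
   positive variance. The first-layer preactivations are iid N(0, sw^2), so conditioning on them
   gives h_{2,1} the characteristic function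
     t |-> L (sw^2 t^2 / (2 N)) ^ N,   where L u = E exp (-u phi(g)^2) and g ~ N(0, sw^2).
   Since E phi(g)^2 is infinite, Fatou's lemma yields n (1 - L (c/n)) --> infinity for all c > 0.
   A Gaussian law would keep this quantity bounded. As N --> infinity it forces the characteristic
   functions to 0 at every t other than 0, and no characteristic function is such a limit, as it
   would be discontinuous at 0. *)

theory Submission
  imports Defs "HOL-Real_Asymp.Real_Asymp"
begin

section \<open>Gaussian laws and their characteristic functions\<close>

text \<open>The affine image also covers the point mass at \<open>s = 0\<close>, so
  \<open>char_gauss\<close> follows without a case split.\<close>

lemma gauss_eq_distr_std_normal:
  assumes "0 \<le> s"
  shows "gauss \<mu> s = distr std_normal_distribution borel (\<lambda>x. \<mu> + s * x)"
proof -
  interpret N: prob_space std_normal_distribution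
    by (rule prob_space_normal_density) simp
  show ?thesis
  proof (cases "s = 0")
    case True
    then show ?thesis by (simp add: gauss_def)
  next
    case False
    then have s: "0 < s" using assms by simp
    have "distributed std_normal_distribution lborel (\<lambda>x. x) std_normal_density"
      unfolding distributed_def by (auto intro!: distr_id2)
    from N.normal_density_affine[OF this, of s \<mu>] s
    have "distr std_normal_distribution lborel (\<lambda>x. \<mu> + s * x) = density lborel (normal_density \<mu> s)"
      by (simp add: distributed_def)
    then show ?thesis
      using s by (simp add: gauss_def cong: distr_cong)
  qed
qed

lemma char_gauss:
  assumes "0 \<le> s"
  shows "char (gauss \<mu> s) t = iexp (t * \<mu>) * complex_of_real (exp (- (s * t)\<^sup>2 / 2))"
proof -
  have "char (gauss \<mu> s) t = (CLINT x|std_normal_distribution. iexp (t * \<mu>) * iexp (s * t * x))"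
    unfolding gauss_eq_distr_std_normal[OF assms] char_def
    by (subst integral_distr) (auto simp: exp_add[symmetric] algebra_simps)
  also have "\<dots> = iexp (t * \<mu>) * char std_normal_distribution (s * t)"
    unfolding char_def by simp
  finally show ?thesis
    by (simp add: char_std_normal_distribution exp_of_real)
qed

text \<open>Independence makes the joint law of \<open>X\<close> and \<open>Y\<close> a product, so
  Fubini allows integrating over \<open>X\<close> first with \<open>Y\<close> frozen at
  \<open>y\<close>. The inner integral is the centred Gaussian characteristic function at
  \<open>t * y\<close>, which is real. The integrands are bounded by 1, so a heavy-tailed
  \<open>Y\<close> is admissible.\<close>

lemma (in prob_space) char_gauss_mult:
  assumes ind: "indep_var borel X borel Y" and X: "distr M borel X = gauss 0 \<tau>" and "0 \<le> \<tau>"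
  shows "char (distr M borel (\<lambda>\<omega>. X \<omega> * Y \<omega>)) t =
    complex_of_real (LINT y|distr M borel Y. exp (- (\<tau> * t * y)\<^sup>2 / 2))"
proof -
  note [measurable] = indep_var_rv1[OF ind] indep_var_rv2[OF ind]
  interpret Y: prob_space "distr M borel Y" by (rule prob_space_distr) simp
  interpret G: prob_space "gauss 0 \<tau>" using \<open>0 \<le> \<tau>\<close> by (rule prob_space_gauss)
  interpret P: pair_prob_space "gauss 0 \<tau>" "distr M borel Y" ..
  have joint: "distr M (borel \<Otimes>\<^sub>M borel) (\<lambda>\<omega>. (X \<omega>, Y \<omega>)) = gauss 0 \<tau> \<Otimes>\<^sub>M distr M borel Y"
    using ind X by (simp add: indep_var_distribution_eq)
  have "char (distr M borel (\<lambda>\<omega>. X \<omega> * Y \<omega>)) t =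
      (CLINT p|distr M (borel \<Otimes>\<^sub>M borel) (\<lambda>\<omega>. (X \<omega>, Y \<omega>)). iexp (t * (fst p * snd p)))"
    unfolding char_def by (simp add: integral_distr)
  also have "\<dots> = (CLINT p|gauss 0 \<tau> \<Otimes>\<^sub>M distr M borel Y. (case p of (x, y) \<Rightarrow> iexp (t * (x * y))))"
    unfolding joint by (simp add: case_prod_beta)
  also have "\<dots> = (CLINT y|distr M borel Y. CLINT x|gauss 0 \<tau>. iexp (t * (x * y)))"
    by (rule P.integral_snd[symmetric])
       (rule P.P.integrable_const_bound[where B=1], auto)
  also have "\<dots> = (CLINT y|distr M borel Y. char (gauss 0 \<tau>) (t * y))"
    unfolding char_def by (simp add: mult_ac)
  also have "\<dots> = (CLINT y|distr M borel Y. complex_of_real (exp (- (\<tau> * t * y)\<^sup>2 / 2)))"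
    using \<open>0 \<le> \<tau>\<close> by (simp only: char_gauss) (simp add: mult_ac)
  finally show ?thesis by (simp only: integral_complex_of_real)
qed

section \<open>Independence of the parameters and the law of the second-layer preactivation\<close>

text \<open>Independence means that the joint law is the product of the marginals. For the
  coordinates the joint map is the identity on \<open>PiM I M\<close>, and each marginal is the
  factor \<open>M i\<close>.\<close>

lemma indep_vars_PiM_coordinates:
  assumes M: "\<And>i. i \<in> I \<Longrightarrow> prob_space (M i)" and "I \<noteq> {}"
  shows "prob_space.indep_vars (PiM I M) M (\<lambda>i \<omega>. \<omega> i) I"
proof -
  interpret prob_space "PiM I M" using M by (rule prob_space_PiM)
  have "distr (PiM I M) (PiM I M) (\<lambda>x. \<lambda>i\<in>I. x i) = distr (PiM I M) (PiM I M) (\<lambda>x. x)"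
    by (rule distr_cong) (auto simp: space_PiM)
  also have "\<dots> = PiM I M"
    by (rule distr_id2) simp
  also have "\<dots> = PiM I (\<lambda>i. distr (PiM I M) (M i) (\<lambda>\<omega>. \<omega> i))"
    by (intro PiM_cong refl distr_PiM_component[symmetric] M)
  finally show ?thesis
    using \<open>I \<noteq> {}\<close> by (subst indep_vars_iff_distr_eq_PiM') auto
qed

text \<open>A centred Gaussian is symmetric, so the signs leave the law of each term unchanged, and
  variances of independent terms add. With \<open>card A = N\<close> and
  \<open>s = \<sigma>w / sqrt N\<close> the result is exactly \<open>gauss 0 \<sigma>w\<close>,
  whatever the input and the width.\<close>

lemma (in prob_space) distr_sum_signed_gauss:
  assumes A: "finite A" "A \<noteq> {}" and ind: "indep_vars (\<lambda>_. borel) X A" and "0 < s"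
    and X: "\<And>i. i \<in> A \<Longrightarrow> distr M borel (X i) = gauss 0 s"
    and c: "\<And>i. i \<in> A \<Longrightarrow> c i \<in> {-1, 1}"
  shows "distr M borel (\<lambda>\<omega>. \<Sum>i\<in>A. X i \<omega> * c i) = gauss 0 (sqrt (real (card A)) * s)"
proof -
  have rv: "random_variable borel (X i)" if "i \<in> A" for i
    using ind that by (simp add: indep_vars_def)
  have ind': "indep_vars (\<lambda>_. borel) (\<lambda>i \<omega>. X i \<omega> * c i) A"
    by (rule indep_vars_compose2[OF ind]) simp
  have "distributed M lborel (X i) (normal_density 0 s)" if "i \<in> A" for i
    using X[OF that] rv[OF that] \<open>0 < s\<close>
    by (simp add: distributed_def gauss_def cong: distr_cong)
  then have "distributed M lborel (\<lambda>\<omega>. X i \<omega> * c i) (normal_density 0 s)" if "i \<in> A" for i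
    using normal_density_affine[of "X i" 0 s "c i" 0] c[OF that] that \<open>0 < s\<close>
    by (auto simp: mult.commute)
  from sum_indep_normal[OF A ind' \<open>0 < s\<close> this]
  have "distributed M lborel (\<lambda>\<omega>. \<Sum>i\<in>A. X i \<omega> * c i) (normal_density 0 (sqrt (real (card A)) * s))"
    using \<open>0 < s\<close> by (simp add: real_sqrt_mult)
  then show ?thesis
    using A \<open>0 < s\<close> by (simp add: distributed_def gauss_def card_eq_0_iff cong: distr_cong)
qed

lemma char_preact_law_2:
  fixes \<phi> :: "real \<Rightarrow> real"
  assumes [measurable]: "\<phi> \<in> borel_measurable borel" and "0 < \<sigma>w" and chi: "range chi \<subseteq> {-1, 1}"
    and D: "2 \<le> D" and N: "1 \<le> N"
  shows "char (preact_law \<phi> chi \<sigma>w 0 D N 2 1) t =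
    complex_of_real ((LINT x|gauss 0 \<sigma>w. exp (- (\<sigma>w\<^sup>2 * t\<^sup>2 / (2 * real N)) * (\<phi> x)\<^sup>2)) ^ N)"
proof -
  let ?M = "param_space \<sigma>w 0 D N" and ?P = "param_dist \<sigma>w 0 N" and ?I = "params D N"
  let ?\<tau> = "\<sigma>w / sqrt (real N)"
  have \<tau>: "0 < ?\<tau>" using \<open>0 < \<sigma>w\<close> N by simp
  interpret prob_space ?M by (rule prob_space_param_space) (use \<open>0 < \<sigma>w\<close> in auto)
  have P: "prob_space (?P p)" for p
    using \<tau> by (cases p) (auto intro!: prob_space_gauss)
  have W1: "Weight 1 i j \<in> ?I" and W2: "Weight 2 i j \<in> ?I"
    and B1: "Bias 1 i \<in> ?I" and B2: "Bias 2 i \<in> ?I"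
    if "i \<in> {1..N}" "j \<in> {1..N}" for i j
    using that D by (auto simp: params_def)
  have one: "1 \<in> {1..N}" using N by auto
  have "indep_vars ?P (\<lambda>p \<omega>. \<omega> p) ?I"
    unfolding param_space_def by (rule indep_vars_PiM_coordinates) (use P W1[OF one one] in auto)
  then have ind: "indep_vars (\<lambda>_. borel) (\<lambda>p \<omega>. \<omega> p) ?I"
    by (rule indep_vars_compose2[where Y="\<lambda>_ x. x"]) (rule measurable_ident_sets, simp)
  have law: "distr ?M borel (\<lambda>\<omega>. \<omega> p) = ?P p" if "p \<in> ?I" for p
    using distr_PiM_component[of ?I ?P, OF P that]
    by (simp add: param_space_def cong: distr_cong)
  \<comment> \<open>With standard deviation 0 the biases are point masses at 0. They vanish only
    almost everywhere on the product space, so they are discarded at the end by comparing laws up to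
    null sets.\<close>
  have bias: "AE \<omega> in ?M. \<omega> (Bias l i) = 0" if "Bias l i \<in> ?I" for l i
  proof -
    have "AE x in return borel (0::real). x = 0"
      by (subst AE_return) auto
    moreover have "?P (Bias l i) = return borel 0"
      by (simp add: gauss_def)
    ultimately have "AE x in ?P (Bias l i). x = 0"
      by metis
    then show ?thesis
      unfolding param_space_def by (rule AE_PiM_component[OF P that])
  qed

  \<comment> \<open>\<open>G j\<close> is the first-layer preactivation of neuron \<open>j\<close>,
    and \<open>Z j\<close> the summand it contributes to the second layer, both with the biases
    dropped.\<close>
  define G where "G j \<omega> = (\<Sum>k=1..N. \<omega> (Weight 1 j k) * chi k)" for j :: nat and \<omega> :: "param \<Rightarrow> real"
  define Z where "Z j \<omega> = \<omega> (Weight 2 1 j) * \<phi> (G j \<omega>)" for j \<omega>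
  have G_meas [measurable]: "G j \<in> borel_measurable ?M" if "j \<in> {1..N}" for j
    unfolding G_def using that by (auto intro!: borel_measurable_sum borel_measurable_times measurable_param W1[simplified])
  have Z_meas: "Z j \<in> borel_measurable ?M" if "j \<in> {1..N}" for j
    unfolding Z_def
    using G_meas[OF that] measurable_param[OF W2[OF one that]] by measurable

  have G_law: "distr ?M borel (G j) = gauss 0 \<sigma>w" if j: "j \<in> {1..N}" for j
  proof -
    \<comment> \<open>Singleton blocks of coordinates turn independence over parameter names into
      independence over the column index \<open>k\<close>.\<close>
    have "indep_vars (\<lambda>k. PiM {Weight 1 j k} (\<lambda>_. borel))
        (\<lambda>k \<omega>. restrict (\<lambda>p. \<omega> p) {Weight 1 j k}) {1..N}"
      by (rule indep_vars_restrict[OF ind]) (use W1[OF j] in \<open>auto simp: disjoint_family_on_def\<close>)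
    from indep_vars_compose2[OF this, of "\<lambda>k \<omega>. \<omega> (Weight 1 j k)" "\<lambda>_. borel"]
    have "indep_vars (\<lambda>_. borel) (\<lambda>k \<omega>. \<omega> (Weight 1 j k)) {1..N}"
      by (simp add: measurable_component_singleton)
    moreover have "distr ?M borel (\<lambda>\<omega>. \<omega> (Weight 1 j k)) = gauss 0 ?\<tau>" if "k \<in> {1..N}" for k
      using law[OF W1[OF j that]] by simp
    ultimately show ?thesis
      using distr_sum_signed_gauss[of "{1..N}" "\<lambda>k \<omega>. \<omega> (Weight 1 j k)" ?\<tau> chi] chi N \<tau>
      by (auto simp: G_def[abs_def])
  qed

  have Z_char: "char (distr ?M borel (Z j)) t =
      complex_of_real (LINT x|gauss 0 \<sigma>w. exp (- (\<sigma>w\<^sup>2 * t\<^sup>2 / (2 * real N)) * (\<phi> x)\<^sup>2))"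
    if j: "j \<in> {1..N}" for j
  proof -
    \<comment> \<open>The two factors of \<open>Z j\<close> read disjoint blocks: \<open>?A\<close>
      is one second-layer weight, \<open>?B\<close> is row \<open>j\<close> of the first-layer
      weights.\<close>
    let ?A = "{Weight 2 1 j}" and ?B = "Weight 1 j ` {1..N}"
    have "indep_var (PiM ?A (\<lambda>_. borel)) (\<lambda>\<omega>. restrict (\<lambda>p. \<omega> p) ?A)
        (PiM ?B (\<lambda>_. borel)) (\<lambda>\<omega>. restrict (\<lambda>p. \<omega> p) ?B)"
      by (rule indep_var_restrict[OF ind]) (use W1[OF j] W2[OF one j] in auto)
    moreover have "(\<lambda>\<omega>. \<omega> (Weight 2 1 j)) \<in> borel_measurable (PiM ?A (\<lambda>_. borel :: real measure))"
      by (rule measurable_component_singleton) simp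
    moreover have "(\<lambda>\<omega>. \<phi> (G j \<omega>)) \<in> borel_measurable (PiM ?B (\<lambda>_. borel :: real measure))"
      unfolding G_def
      by (intro measurable_compose[OF _ assms(1)] borel_measurable_sum borel_measurable_times
          measurable_component_singleton) auto
    ultimately have "indep_var borel ((\<lambda>\<omega>. \<omega> (Weight 2 1 j)) \<circ> (\<lambda>\<omega>. restrict (\<lambda>p. \<omega> p) ?A))
        borel ((\<lambda>\<omega>. \<phi> (G j \<omega>)) \<circ> (\<lambda>\<omega>. restrict (\<lambda>p. \<omega> p) ?B))"
      by (rule indep_var_compose)
    then have "indep_var borel (\<lambda>\<omega>. \<omega> (Weight 2 1 j)) borel (\<lambda>\<omega>. \<phi> (G j \<omega>))"
      by (simp add: comp_def G_def)
    then have "char (distr ?M borel (Z j)) t =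
        complex_of_real (LINT y|distr ?M borel (\<lambda>\<omega>. \<phi> (G j \<omega>)). exp (- (?\<tau> * t * y)\<^sup>2 / 2))"
      unfolding Z_def[abs_def] using law[OF W2[OF one j]] \<tau> by (intro char_gauss_mult) auto
    also have "distr ?M borel (\<lambda>\<omega>. \<phi> (G j \<omega>)) = distr (gauss 0 \<sigma>w) borel \<phi>"
      using G_meas[OF j] by (simp add: G_law[OF j, symmetric] distr_distr comp_def)
    also have "(LINT y|distr (gauss 0 \<sigma>w) borel \<phi>. exp (- (?\<tau> * t * y)\<^sup>2 / 2)) =
        (LINT x|gauss 0 \<sigma>w. exp (- (?\<tau> * t * \<phi> x)\<^sup>2 / 2))"
      by (rule integral_distr) auto
    also have "(\<lambda>x. - (?\<tau> * t * \<phi> x)\<^sup>2 / 2) = (\<lambda>x. - (\<sigma>w\<^sup>2 * t\<^sup>2 / (2 * real N)) * (\<phi> x)\<^sup>2)"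
      using N by (auto simp: power_mult_distrib power_divide)
    finally show ?thesis .
  qed

  have Z_indep: "indep_vars (\<lambda>_. borel) Z {1..N}"
  proof -
    \<comment> \<open>\<open>K j\<close> collects every parameter that \<open>Z j\<close> reads.
      Distinct \<open>j\<close> use distinct rows of the first layer and distinct second-layer
      weights, so the blocks are disjoint.\<close>
    define K where "K j = insert (Weight 2 1 j) (Weight 1 j ` {1..N})" for j
    have "indep_vars (\<lambda>j. PiM (K j) (\<lambda>_. borel)) (\<lambda>j \<omega>. restrict (\<lambda>p. \<omega> p) (K j)) {1..N}"
      by (rule indep_vars_restrict[OF ind])
        (use W1 W2[OF one] in \<open>auto simp: K_def disjoint_family_on_def\<close>)
    moreover have "Z j \<in> borel_measurable (PiM (K j) (\<lambda>_. borel :: real measure))" for j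
      unfolding Z_def G_def
      by (intro measurable_compose[OF _ assms(1)] borel_measurable_sum borel_measurable_times
          measurable_component_singleton) (auto simp: K_def)
    ultimately have "indep_vars (\<lambda>_. borel) (\<lambda>j \<omega>. Z j (restrict (\<lambda>p. \<omega> p) (K j))) {1..N}"
      by (rule indep_vars_compose2)
    then show ?thesis
      by (simp add: Z_def[abs_def] G_def K_def)
  qed

  have "AE \<omega> in ?M. \<forall>j\<in>{1..N}. \<omega> (Bias 1 j) = 0"
    by (rule AE_finite_allI) (use bias B1 in auto)
  then have "AE \<omega> in ?M. preact \<phi> chi N \<omega> 2 1 = (\<Sum>j=1..N. Z j \<omega>)"
    using bias[OF B2[OF one one]]
  proof eventually_elim
    case (elim \<omega>)
    then show ?case
      by (auto simp: preact_def affine_layer_def Z_def G_def intro!: sum.cong)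
  qed
  then have "preact_law \<phi> chi \<sigma>w 0 D N 2 1 = distr ?M borel (\<lambda>\<omega>. \<Sum>j=1..N. Z j \<omega>)"
    unfolding preact_law_def using D N Z_meas
    by (intro distr_cong_AE measurable_preact borel_measurable_sum) auto
  also have "char \<dots> t = (\<Prod>j=1..N. char (distr ?M borel (Z j)) t)"
    by (rule char_distr_sum[OF Z_indep])
  finally show ?thesis by (simp add: Z_char)
qed

section \<open>Laplace transforms of variables with infinite mean\<close>

text \<open>The functions \<open>n * (1 - exp (- Y x / n))\<close> are nonnegative and tend
  pointwise to \<open>Y x\<close>, so Fatou's lemma transfers the infinite integral of
  \<open>Y\<close> to the limit.\<close>

lemma (in prob_space) laplace_defect_at_top:
  assumes [measurable]: "Y \<in> borel_measurable M" and Y: "\<And>x. 0 \<le> Y x"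
    and inf: "(\<integral>\<^sup>+x. ennreal (Y x) \<partial>M) = \<infinity>"
  shows "filterlim (\<lambda>n. real n * (1 - (LINT x|M. exp (- Y x / real n)))) at_top sequentially"
proof -
  let ?f = "\<lambda>n x. real n * (1 - exp (- Y x / real n))"
  have f_nonneg: "0 \<le> ?f n x" for n x using Y[of x] by simp
  have int: "integrable M (\<lambda>x. exp (- Y x / real n))" for n
    by (rule integrable_const_bound[where B=1]) (use Y in auto)
  \<comment> \<open>This covers \<open>n = 0\<close> too, where both sides are 0.\<close>
  have eq: "(\<integral>\<^sup>+x. ennreal (?f n x) \<partial>M) = ennreal (real n * (1 - (LINT x|M. exp (- Y x / real n))))" for n
    using int[of n] f_nonneg by (subst nn_integral_eq_integral) (auto simp: prob_space)
  have "(\<lambda>n. ?f n x) \<longlonglongrightarrow> Y x" for x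
    by real_asymp
  then have "liminf (\<lambda>n. ennreal (?f n x)) = ennreal (Y x)" for x
    by (intro lim_imp_Liminf tendsto_ennrealI) auto
  then have "\<infinity> = (\<integral>\<^sup>+x. liminf (\<lambda>n. ennreal (?f n x)) \<partial>M)"
    using inf by simp
  also have "\<dots> \<le> liminf (\<lambda>n. \<integral>\<^sup>+x. ennreal (?f n x) \<partial>M)"
    by (rule nn_integral_liminf) simp
  finally have "liminf (\<lambda>n. \<integral>\<^sup>+x. ennreal (?f n x) \<partial>M) = \<infinity>"
    by (simp add: top_unique)
  then have "(\<lambda>n. \<integral>\<^sup>+x. ennreal (?f n x) \<partial>M) \<longlonglongrightarrow> \<infinity>"
    using Liminf_le_Limsup[of sequentially "\<lambda>n. \<integral>\<^sup>+x. ennreal (?f n x) \<partial>M"]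
    by (intro Liminf_eq_Limsup) (auto simp: top_unique)
  then show ?thesis
    unfolding eq by (simp add: ennreal_tendsto_top_eq_at_top)
qed

text \<open>The quartic exponent outgrows the quadratic one of the density, so density times
  integrand stays above a positive constant \<open>\<delta>\<close> on the whole line, which has
  infinite Lebesgue measure.\<close>

lemma nn_integral_exp_quartic_gauss:
  assumes "0 < \<sigma>" "0 < c"
  shows "(\<integral>\<^sup>+x. ennreal (c * (exp (x ^ 4))\<^sup>2) \<partial>gauss 0 \<sigma>) = \<infinity>"
proof -
  \<comment> \<open>\<open>a\<close> writes the exponent of the density as
    \<open>- a * x\<^sup>2\<close>. By completing the square,
    \<open>2 * x ^ 4 - a * x\<^sup>2\<close> has minimum \<open>- a\<^sup>2 / 8\<close>, at
    \<open>x\<^sup>2 = a / 4\<close>; \<open>\<delta>\<close> combines this with the normalising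
    constant and \<open>c\<close>.\<close>
  define a where "a = 1 / (2 * \<sigma>\<^sup>2)"
  define \<delta> where "\<delta> = exp (- a\<^sup>2 / 8) / sqrt (2 * pi * \<sigma>\<^sup>2) * c"
  have \<delta>: "0 < \<delta>" using assms by (simp add: \<delta>_def)
  have bound: "\<delta> \<le> normal_density 0 \<sigma> x * (c * (exp (x ^ 4))\<^sup>2)" for x
  proof -
    have "0 \<le> 2 * (x\<^sup>2 - a / 4)\<^sup>2" by simp
    also have "\<dots> = 2 * x ^ 4 - a * x\<^sup>2 + a\<^sup>2 / 8"
      by (simp add: power2_eq_square power4_eq_xxxx algebra_simps)
    finally have "exp (- a\<^sup>2 / 8) \<le> exp (- a * x\<^sup>2 + 2 * x ^ 4)" by simp
    also have "\<dots> = exp (- x\<^sup>2 / (2 * \<sigma>\<^sup>2)) * (exp (x ^ 4))\<^sup>2"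
      unfolding exp_double[symmetric] exp_add[symmetric] a_def by simp
    finally show ?thesis
      using assms by (simp add: \<delta>_def normal_density_def divide_right_mono mult_right_mono)
  qed
  have "\<infinity> = (\<integral>\<^sup>+(x::real). ennreal \<delta> \<partial>lborel)"
    using \<delta> by (simp add: ennreal_mult_top)
  also have "\<dots> \<le> (\<integral>\<^sup>+x. ennreal (normal_density 0 \<sigma> x * (c * (exp (x ^ 4))\<^sup>2)) \<partial>lborel)"
    by (intro nn_integral_mono ennreal_leI bound)
  also have "\<dots> = (\<integral>\<^sup>+x. ennreal (c * (exp (x ^ 4))\<^sup>2) \<partial>gauss 0 \<sigma>)"
    using assms by (simp add: gauss_def nn_integral_density ennreal_mult)
  finally show ?thesis by (simp add: top_unique)
qed

section \<open>Non-Gaussianity at finite width and divergence\<close>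

theorem proposition9:
  shows "\<exists>\<phi> :: real \<Rightarrow> real. \<phi> \<in> borel_measurable borel \<and>
    (\<forall>(\<sigma>w :: real) (\<sigma>b :: real) (chi :: nat \<Rightarrow> real) (D :: nat).
       0 < \<sigma>w \<longrightarrow> \<sigma>b = 0 \<longrightarrow> range chi \<subseteq> {-1, 1} \<longrightarrow> 2 \<le> D \<longrightarrow>
         (\<forall>N\<ge>1. \<not> gaussian_distribution (preact_law \<phi> chi \<sigma>w \<sigma>b D N 2 1)) \<and>
         \<not> (\<exists>\<nu>. real_distribution \<nu> \<and>
               weak_conv_m (\<lambda>n. preact_law \<phi> chi \<sigma>w \<sigma>b D (Suc n) 2 1) \<nu>))"
proof (intro exI[of _ "\<lambda>x. exp (x ^ 4)"] conjI allI impI)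
  let ?\<phi> = "\<lambda>x::real. exp (x ^ 4)"
  show meas: "?\<phi> \<in> borel_measurable borel" by measurable
  fix \<sigma>w \<sigma>b :: real and chi :: "nat \<Rightarrow> real" and D :: nat
  assume \<sigma>: "0 < \<sigma>w" "\<sigma>b = 0" and chi: "range chi \<subseteq> {-1, 1}" and D: "2 \<le> D"
  interpret G: prob_space "gauss 0 \<sigma>w" using \<sigma> by (intro prob_space_gauss) simp
  \<comment> \<open>Both claims rest on \<open>defect\<close> for this Laplace transform: (a) with
    the width fixed and \<open>t\<close> shrinking, (b) with \<open>t\<close> fixed and the width
    growing.\<close>
  define L where "L u = (LINT x|gauss 0 \<sigma>w. exp (- u * (?\<phi> x)\<^sup>2))" for u
  have char: "char (preact_law ?\<phi> chi \<sigma>w \<sigma>b D N 2 1) t =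
      complex_of_real (L (\<sigma>w\<^sup>2 * t\<^sup>2 / (2 * real N)) ^ N)" if "1 \<le> N" for N t
    using char_preact_law_2[OF meas \<sigma>(1) chi D that] \<sigma>(2) by (simp add: L_def)
  have L_nonneg: "0 \<le> L u" for u
    unfolding L_def by simp
  have defect: "filterlim (\<lambda>n. real n * (1 - L (c / real n))) at_top sequentially" if "0 < c" for c
    using G.laplace_defect_at_top[of "\<lambda>x. c * (?\<phi> x)\<^sup>2"] nn_integral_exp_quartic_gauss[OF \<sigma>(1) that] that
    by (simp add: L_def)

  show "\<not> gaussian_distribution (preact_law ?\<phi> chi \<sigma>w \<sigma>b D N 2 1)" if N: "1 \<le> N" for N
  proof
    assume "gaussian_distribution (preact_law ?\<phi> chi \<sigma>w \<sigma>b D N 2 1)"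
    then obtain \<mu> s where s: "0 \<le> s" and eq: "preact_law ?\<phi> chi \<sigma>w \<sigma>b D N 2 1 = gauss \<mu> s"
      by (auto simp: gaussian_distribution_def)
    define c where "c = \<sigma>w\<^sup>2 / (2 * real N)"
    have c: "0 < c" using \<sigma> N by (simp add: c_def)
    \<comment> \<open>The characteristic function is sampled at \<open>t = 1 / sqrt n\<close>, where
      the argument of \<open>L\<close> becomes \<open>c / n\<close>. Taking moduli removes the phase
      due to the unknown mean \<open>\<mu>\<close>.\<close>
    have "real n * (1 - L (c / real n)) \<le> s\<^sup>2 / 2" if n: "1 \<le> n" for n
    proof -
      define t where "t = sqrt (1 / real n)"
      have t2: "t\<^sup>2 = 1 / real n" by (simp add: t_def)
      have "\<sigma>w\<^sup>2 * t\<^sup>2 / (2 * real N) = c / real n"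
        by (simp add: t2 c_def)
      then have "cmod (char (gauss \<mu> s) t) = L (c / real n) ^ N"
        unfolding eq[symmetric] char[OF N]
        using L_nonneg by (simp add: norm_power)
      moreover have "cmod (char (gauss \<mu> s) t) = exp (- s\<^sup>2 / (2 * real n))"
        unfolding char_gauss[OF s] by (simp add: norm_mult t2 power_mult_distrib)
      ultimately have "exp (- s\<^sup>2 / (2 * real n)) = L (c / real n) ^ N" by simp
      moreover have L_le_1: "L (c / real n) \<le> 1"
        unfolding L_def by (rule G.integral_le_const) (auto intro!: G.integrable_const_bound[where B=1] simp: c less_imp_le)
      \<comment> \<open>Since \<open>L (c / n)\<close> lies between 0 and 1, its \<open>N\<close>-th
        power is at most itself, which removes the exponent; the tangent bound on \<open>exp\<close>
        then makes the estimate linear in \<open>1 / n\<close>.\<close>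
      ultimately have "exp (- s\<^sup>2 / (2 * real n)) \<le> L (c / real n)"
        using power_decreasing[of 1 N "L (c / real n)"] L_nonneg N by simp
      with exp_ge_add_one_self[of "- s\<^sup>2 / (2 * real n)"]
      have "1 - L (c / real n) \<le> s\<^sup>2 / (2 * real n)" by simp
      then show ?thesis using n by (simp add: field_simps)
    qed
    moreover have "eventually (\<lambda>n. s\<^sup>2 / 2 < real n * (1 - L (c / real n)) \<and> 1 \<le> n) sequentially"
      using defect[OF c] by (intro eventually_conj eventually_ge_at_top) (simp only: filterlim_at_top_dense)
    ultimately show False
      by (auto simp: eventually_sequentially not_le[symmetric])
  qed

  show "\<not> (\<exists>\<nu>. real_distribution \<nu> \<and>
      weak_conv_m (\<lambda>n. preact_law ?\<phi> chi \<sigma>w \<sigma>b D (Suc n) 2 1) \<nu>)"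
  proof (intro notI, elim exE conjE)
    fix \<nu> :: "real measure"
    assume \<nu>: "real_distribution \<nu>"
      and conv: "weak_conv_m (\<lambda>n. preact_law ?\<phi> chi \<sigma>w \<sigma>b D (Suc n) 2 1) \<nu>"
    interpret \<nu>: real_distribution \<nu> by fact
    have law: "real_distribution (preact_law ?\<phi> chi \<sigma>w \<sigma>b D (Suc n) 2 1)" for n
    proof -
      interpret prob_space "param_space \<sigma>w \<sigma>b D (Suc n)"
        using \<sigma> by (intro prob_space_param_space) auto
      show ?thesis
        unfolding preact_law_def using D by (intro real_distribution_distr measurable_preact meas) auto
    qed
    have "char \<nu> t = 0" if t: "t \<noteq> 0" for t
    proof -
      \<comment> \<open>Here \<open>n\<close> plays the role of the width, and \<open>c / n\<close>
        is the argument of \<open>L\<close> in \<open>char\<close>.\<close>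
      define c where "c = \<sigma>w\<^sup>2 * t\<^sup>2 / 2"
      have c: "0 < c" using \<sigma> t by (simp add: c_def)
      \<comment> \<open>This is \<open>L u \<le> exp (L u - 1)\<close> raised to the power
        \<open>n\<close>; it turns the diverging defect into decay of the characteristic
        functions.\<close>
      have upper: "L u ^ n \<le> exp (- (real n * (1 - L u)))" for u n
        using power_mono[OF exp_ge_add_one_self[of "L u - 1"], of n] L_nonneg[of u]
        by (simp add: exp_of_nat_mult[symmetric] algebra_simps)
      have "(\<lambda>n. exp (- (real n * (1 - L (c / real n))))) \<longlonglongrightarrow> 0"
        using defect[OF c] by (intro filterlim_compose[OF exp_at_bot] filterlim_compose[OF filterlim_uminus_at_bot_at_top])
      then have "(\<lambda>n. L (c / real n) ^ n) \<longlonglongrightarrow> 0"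
        by (rule tendsto_sandwich[OF always_eventually always_eventually tendsto_const, rotated 2])
          (intro allI upper zero_le_power L_nonneg)+
      \<comment> \<open>Widths start at 1, hence the shift to \<open>Suc n\<close>.\<close>
      then have "(\<lambda>n. complex_of_real (L (c / real (Suc n)) ^ Suc n)) \<longlonglongrightarrow> of_real 0"
        by (intro tendsto_of_real) (rule LIMSEQ_Suc)
      then have "(\<lambda>n. char (preact_law ?\<phi> chi \<sigma>w \<sigma>b D (Suc n) 2 1) t) \<longlonglongrightarrow> 0"
        by (subst char) (simp_all add: c_def)
      with levy_continuity1[OF law \<nu> conv, of t] show ?thesis
        by (rule LIMSEQ_unique)
    qed
    \<comment> \<open>The punctured limit ignores the value at 0, so vanishing elsewhere determines
      it.\<close>
    then have "char \<nu> \<midarrow>0\<rightarrow> 0"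
      by (intro tendsto_eventually) (auto simp: eventually_at_filter)
    moreover have "char \<nu> \<midarrow>0\<rightarrow> 1"
      using \<nu>.isCont_char[of 0] by (simp add: isCont_def \<nu>.char_zero)
    ultimately show False
      using LIM_unique[of "char \<nu>" 0 0 1] by simp
  qed
qed

end
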